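(* Among the flat Lie algebras on $2\mathfrak g_{2,1}\oplus\mathfrak g_1$ given in the list of the context: (i) the associative ones are exactly $\mathfrak h_{1,1}^{\lambda=1}$, $\mathfrak h_{1,5}^{\lambda=1}$, $\mathfrak h_{2,1}^{\mu=-1}$, $\mathfrak h_{2,2}^{\mu=-1}$, $\mathfrak h_{2,3}$, $\mathfrak h_{2,10}^{\mu=-1,\mu_1=1}$; (ii) the Novikov ones are exactly $\mathfrak h_{1,1},\mathfrak h_{1,5},\mathfrak h_{4,1},\mathfrak h_{4,2}$; (iii) the bi-symmetric ones are exactly $\mathfrak h_{1,1}^{\lambda=1}$, $\mathfrak h_{1,5}^{\lambda=1}$, $\mathfrak h_{2,1}^{\mu=-1}$, $\mathfrak h_{2,2}^{\mu=-1}$, $\mathfrak h_{2,3}$, $\mathfrak h_{3,1}$, $\mathfrak h_{3,2}$, $\mathfrak h_{3,5}$, $\mathfrak h_{4,1}$, $\mathfrak h_{4,2}$; (iv) the complete ones are exactly $\mathfrak h_{1,1}^{\lambda=0,\delta=0}$, $\mathfrak h_{1,5}^{\lambda=0}$, $\mathfrak h_{1,10}^{\lambda_1=0}$.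
   Context: A flat Lie algebra is a real Lie algebra $\mathfrak g$ with a bilinear product $X\cdot Y=\nabla_XY$ such that $X\cdot Y-Y\cdot X=[X,Y]$ and $[X,Y]\cdot Z=X\cdot(Y\cdot Z)-Y\cdot(X\cdot Z)$. Put $R_X(Y)=Y\cdot X$ and $(X,Y,Z)=(X\cdot Y)\cdot Z-X\cdot(Y\cdot Z)$. It is associative if $(X,Y,Z)=0$ for all $X,Y,Z$; Novikov if $R_XR_Y=R_YR_X$ for all $X,Y$; bi-symmetric if $(X,Y,Z)=(X,Z,Y)$ for all $X,Y,Z$; complete if every $R_X$ is nilpotent. A superscript restricts the indicated parameters to the indicated values; parameters not mentioned take all admissible values. List on the Lie algebra $2\mathfrak g_{2,1}\oplus\mathfrak g_1$ with basis $e_1,e_2,e_3$ and only nonzero bracket $[e_1,e_2]=e_1$ (only nonzero products $e_ie_j=e_i\cdot e_j$ given; $\delta\in\{0,1\}$, $\varepsilon,\varepsilon_1\in\{1,-1\}$): $\mathfrak h_{1,1}$: $e_1e_2=\lambda e_1,\ e_2e_1=(\lambda-1)e_1,\ e_2e_2=\lambda e_2,\ e_3e_3=\delta e_3$; $\lambda\in\mathbb R$. $\mathfrak h_{1,2}$: $e_1e_2=-e_1+e_3,\ e_2e_1=-2e_1+e_3,\ e_2e_2=-e_2,\ e_2e_3=-e_3,\ e_3e_2=-e_3$. $\mathfrak h_{1,3}$: $e_1e_2=e_1,\ e_2e_2=e_2,\ e_3e_3=e_1+\delta e_3$. $\mathfrak h_{1,4}$: $e_1e_1=\varepsilon_1e_3,\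 e_1e_2=2e_1,\ e_2e_1=e_1,\ e_2e_2=2e_2$. $\mathfrak h_{1,5}$: $e_1e_2=\lambda e_1,\ e_2e_1=(\lambda-1)e_1,\ e_2e_2=\lambda e_2+\delta e_3,\ e_2e_3=\lambda e_3,\ e_3e_2=\lambda e_3$; $\lambda\in\mathbb R$. $\mathfrak h_{1,6}$: $e_1e_2=e_1,\ e_2e_2=e_2+\delta e_3,\ e_2e_3=e_1+e_3,\ e_3e_2=e_1+e_3$. $\mathfrak h_{1,7}$: $e_1e_2=-e_1,\ e_1e_3=e_1,\ e_2e_1=-2e_1,\ e_2e_2=-e_2,\ e_2e_3=e_2,\ e_3e_1=e_1,\ e_3e_2=e_2,\ e_3e_3=e_3$. $\mathfrak h_{1,8}$: $e_2e_1=-e_1,\ e_2e_2=\lambda_1e_3,\ e_2e_3=e_2,\ e_3e_2=e_2,\ e_3e_3=e_3$; $\lambda_1\in\mathbb R$. $\mathfrak h_{1,9}$: $e_1e_2=\lambda e_1,\ e_1e_3=e_1,\ e_2e_1=(\lambda-1)e_1,\ e_2e_2=\lambda e_2,\ e_2e_3=e_2,\ e_3e_1=e_1,\ e_3e_2=e_2,\ e_3e_3=\lambda_1e_2+(1-\lambda\lambda_1)e_3$; $\lambda\in\mathbb R$, $\lambda_1\in\mathbb R\setminus\{0\}$. $\mathfrak h_{1,10}$: $e_2e_1=-e_1,\ e_3e_3=\varepsilon e_2+\lambda_1e_3$; $\lambda_1\in\mathbb R$. $\mathfrak h_{1,11}$: $e_1e_2=e_1,\ e_1e_3=e_1,\ e_2e_2=e_2,\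 e_2e_3=e_2,\ e_3e_1=e_1,\ e_3e_2=e_2,\ e_3e_3=e_1+e_3$. $\mathfrak h_{1,12}$: $e_1e_3=e_1,\ e_2e_1=-e_1,\ e_2e_3=e_2,\ e_3e_1=e_1,\ e_3e_2=e_2,\ e_3e_3=\lambda_1e_2+e_3$; $\lambda_1\in\mathbb R$. $\mathfrak h_{1,13}$: $e_1e_3=e_1,\ e_2e_1=-e_1,\ e_3e_1=e_1,\ e_3e_3=\lambda_2e_2+e_3$; $\lambda_2\in\mathbb R$. $\mathfrak h_{2,1}$: $e_2e_1=-e_1,\ e_2e_2=\mu e_2,\ e_3e_3=\delta e_3$; $\mu\in\mathbb R\setminus\{0\}$. $\mathfrak h_{2,2}$: $e_2e_1=-e_1,\ e_2e_2=\mu e_2,\ e_2e_3=\mu e_3,\ e_3e_2=\mu e_3$; $\mu\in\mathbb R\setminus\{0\}$. $\mathfrak h_{2,3}$: $e_2e_1=-e_1,\ e_2e_2=-e_2,\ e_2e_3=-e_3,\ e_3e_2=-e_3$. $\mathfrak h_{2,4}$: $e_2e_1=-e_1,\ e_2e_2=-e_2,\ e_2e_3=-e_3,\ e_3e_2=-e_3,\ e_3e_3=e_1+\delta e_3$. $\mathfrak h_{2,5}$: $e_1e_1=\varepsilon_1e_3,\ e_2e_1=-e_1,\ e_2e_2=-2e_2,\ e_2e_3=-2e_3,\ e_3e_2=-2e_3$. $\mathfrak h_{2,6}$: $e_1e_2=e_3,\ e_2e_1=-e_1+e_3,\ e_2e_2=e_2$. $\mathfrak h_{2,7}$: $e_1e_3=e_1,\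 e_2e_1=-e_1,\ e_2e_2=\mu e_2,\ e_3e_1=e_1,\ e_3e_3=e_3$; $\mu\in\mathbb R\setminus\{0\}$. $\mathfrak h_{2,8}$: $e_1e_3=\delta_1e_1+\delta_2e_2,\ e_2e_1=-e_1,\ e_2e_2=-e_2,\ e_3e_1=\delta_1e_1+\delta_2e_2,\ e_3e_3=\delta_1e_3$; $\delta_1,\delta_2\in\{0,1\}$, $\delta_1^2+\delta_2^2\neq0$. $\mathfrak h_{2,9}$: $e_2e_1=-e_1,\ e_2e_2=\mu e_2,\ e_2e_3=\mu e_3,\ e_3e_2=\mu e_3,\ e_3e_3=\varepsilon e_2+\mu_1e_3$; $\mu\in\mathbb R\setminus\{0\}$, $\mu_1\in\mathbb R$. $\mathfrak h_{2,10}$: $e_1e_3=e_1,\ e_2e_1=-e_1,\ e_2e_2=\mu e_2,\ e_2e_3=\mu_1e_2,\ e_3e_1=e_1,\ e_3e_2=\mu_1e_2,\ e_3e_3=\frac{\mu_1(\mu_1-1)}{\mu}e_2+e_3$; $\mu\in\mathbb R\setminus\{0\}$, $\mu_1\in\mathbb R$. $\mathfrak h_{2,11}$: $e_2e_1=-e_1,\ e_2e_2=\mu e_2,\ e_2e_3=e_2,\ e_3e_2=e_2,\ e_3e_3=\frac1\mu e_2$; $\mu\in\mathbb R\setminus\{0\}$. $\mathfrak h_{2,12}$: $e_2e_1=-e_1,\ e_2e_2=-e_2,\ e_2e_3=e_2,\ e_3e_2=e_2,\ e_3e_3=e_3$. $\mathfrak h_{2,13}$: $e_2e_1=-e_1,\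 e_2e_2=-e_2,\ e_2e_3=e_1,\ e_3e_2=e_1$. $\mathfrak h_{2,14}$: $e_1e_3=e_1,\ e_2e_1=-e_1,\ e_2e_2=-e_2,\ e_2e_3=e_1+e_2,\ e_3e_1=e_1,\ e_3e_2=e_1+e_2,\ e_3e_3=-e_1+e_3$. $\mathfrak h_{2,15}$: $e_2e_1=-e_1,\ e_2e_2=-e_2+\mu_2e_3,\ e_2e_3=e_2,\ e_3e_2=e_2,\ e_3e_3=e_3$; $\mu_2\in\mathbb R\setminus\{0\}$. $\mathfrak h_{2,16}$: $e_2e_1=-e_1,\ e_2e_2=-e_2+\delta e_3,\ e_2e_3=e_1,\ e_3e_2=e_1$. $\mathfrak h_{3,1}$: $e_2e_1=-e_1,\ e_2e_2=e_1-e_2,\ e_3e_3=\delta e_3$. $\mathfrak h_{3,2}$: $e_2e_1=-e_1,\ e_2e_2=e_1-e_2,\ e_2e_3=-e_3,\ e_3e_2=-e_3$. $\mathfrak h_{3,3}$: $e_2e_1=-e_1,\ e_2e_2=e_1-e_2,\ e_2e_3=-e_3,\ e_3e_2=-e_3,\ e_3e_3=\lambda_1e_1+e_3$; $\lambda_1\in\mathbb R\setminus\{0\}$. $\mathfrak h_{3,4}$: $e_2e_1=-e_1,\ e_2e_2=e_1-e_2,\ e_2e_3=-e_3,\ e_3e_2=-e_3,\ e_3e_3=\varepsilon_1e_1$. $\mathfrak h_{3,5}$: $e_1e_3=e_1,\ e_2e_1=-e_1,\ e_2e_2=e_1-e_2,\ e_2e_3=e_2,\ e_3e_1=e_1,\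 e_3e_2=e_2,\ e_3e_3=e_3$. $\mathfrak h_{3,6}$: $e_1e_3=e_1,\ e_2e_1=-e_1,\ e_2e_2=e_1-e_2,\ e_2e_3=\lambda_2e_1+e_2,\ e_3e_1=e_1,\ e_3e_2=\lambda_2e_1+e_2,\ e_3e_3=-\lambda_2e_1+e_3$; $\lambda_2\in\mathbb R\setminus\{0\}$. $\mathfrak h_{4,1}$: $e_1e_2=e_1,\ e_2e_2=e_1+e_2,\ e_3e_3=\delta e_3$. $\mathfrak h_{4,2}$: $e_1e_2=e_1,\ e_2e_2=e_1+e_2,\ e_2e_3=e_3,\ e_3e_2=e_3$. $\mathfrak h_{4,3}$: $e_1e_2=e_1,\ e_2e_2=e_1+e_2,\ e_3e_3=\lambda_1e_1+e_3$; $\lambda_1\in\mathbb R\setminus\{0\}$. $\mathfrak h_{4,4}$: $e_1e_2=e_1,\ e_2e_2=e_1+e_2,\ e_3e_3=\varepsilon_1e_1$. $\mathfrak h_{4,5}$: $e_1e_2=e_1,\ e_1e_3=e_1,\ e_2e_2=e_1+e_2,\ e_2e_3=e_2,\ e_3e_1=e_1,\ e_3e_2=e_2,\ e_3e_3=\lambda_1e_1+e_3$; $\lambda_1\in\mathbb R\setminus\{0\}$. $\mathfrak h_{4,6}$: $e_1e_2=e_1,\ e_2e_2=e_1+e_2,\ e_3e_3=\varepsilon e_1+\lambda_2e_3$; $\lambda_2\in\mathbb R$, $\lambda_2\neq\pm1$. $\mathfrak h_{5,1}$: $e_1e_1=\varepsilon e_2,\ e_2e_1=-e_1,\ e_2e_2=-2e_2,\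 e_3e_3=\delta e_3$. $\mathfrak h_{5,2}$: $e_1e_1=\varepsilon e_2,\ e_1e_3=e_1,\ e_2e_1=-e_1,\ e_2e_2=-2e_2,\ e_2e_3=e_2,\ e_3e_1=e_1,\ e_3e_2=e_2,\ e_3e_3=e_3$.
   Formalization: In (iii) the algebra h_{2,10} with μ=-1, μ_1=1 is added to the bi-symmetric ones: it is associative by (i), so all associators vanish and it is bi-symmetric, though the printed list omits it. *)

theory Defs
  imports "HOL-Analysis.Analysis"
begin

definition lie_algebra :: "('a::real_vector \<Rightarrow> 'a \<Rightarrow> 'a) \<Rightarrow> bool" where
  "lie_algebra br \<longleftrightarrow>
     bilinear br \<and> (\<forall>x. br x x = 0) \<and>
     (\<forall>x y z. br x (br y z) + br y (br z x) + br z (br x y) = 0)"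

definition flat_lie_algebra ::
    "('a::real_vector \<Rightarrow> 'a \<Rightarrow> 'a) \<Rightarrow> ('a \<Rightarrow> 'a \<Rightarrow> 'a) \<Rightarrow> bool" where
  "flat_lie_algebra br p \<longleftrightarrow>
     lie_algebra br \<and> bilinear p \<and>
     (\<forall>x y. p x y - p y x = br x y) \<and>
     (\<forall>x y z. p (br x y) z = p x (p y z) - p y (p x z))"

definition right_mult :: "('a \<Rightarrow> 'a \<Rightarrow> 'a) \<Rightarrow> 'a \<Rightarrow> 'a \<Rightarrow> 'a" where
  "right_mult p x y = p y x"

definition associator :: "('a::real_vector \<Rightarrow> 'a \<Rightarrow> 'a) \<Rightarrow> 'a \<Rightarrow> 'a \<Rightarrow> 'a \<Rightarrow> 'a" where
  "associator p x y z = p (p x y) z - p x (p y z)"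

definition associative_prod :: "('a::real_vector \<Rightarrow> 'a \<Rightarrow> 'a) \<Rightarrow> bool" where
  "associative_prod p \<longleftrightarrow> (\<forall>x y z. associator p x y z = 0)"

definition novikov_prod :: "('a::real_vector \<Rightarrow> 'a \<Rightarrow> 'a) \<Rightarrow> bool" where
  "novikov_prod p \<longleftrightarrow>
     (\<forall>x y. right_mult p x \<circ> right_mult p y = right_mult p y \<circ> right_mult p x)"

definition bisymmetric_prod :: "('a::real_vector \<Rightarrow> 'a \<Rightarrow> 'a) \<Rightarrow> bool" where
  "bisymmetric_prod p \<longleftrightarrow> (\<forall>x y z. associator p x y z = associator p x z y)"

(* So every associative algebra of the list is also bi-symmetric.  The source
   lists H2_10 (- 1) 1 as associative but omits it from the bi-symmetric ones; it has to be
   included there. *)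
lemma associative_imp_bisymmetric: "associative_prod p \<Longrightarrow> bisymmetric_prod p"
  by (simp add: associative_prod_def bisymmetric_prod_def)

definition nilpotent_map :: "('a::real_vector \<Rightarrow> 'a) \<Rightarrow> bool" where
  "nilpotent_map f \<longleftrightarrow> (\<exists>n. f ^^ n = (\<lambda>_. 0))"

definition complete_prod :: "('a::real_vector \<Rightarrow> 'a \<Rightarrow> 'a) \<Rightarrow> bool" where
  "complete_prod p \<longleftrightarrow> (\<forall>x. nilpotent_map (right_mult p x))"

abbreviation e1 :: "real^3" where "e1 \<equiv> axis 1 1"
abbreviation e2 :: "real^3" where "e2 \<equiv> axis 2 1"
abbreviation e3 :: "real^3" where "e3 \<equiv> axis 3 1"

(* Bilinear product from a list of its nonzero values: an entry ((i, j), v) says that the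
   product of the i-th and j-th basis vectors is v.  Entries with equal keys would add up, so
   a pair (i, j) may be listed only once. *)
definition table_prod :: "((3 \<times> 3) \<times> (real^3)) list \<Rightarrow> real^3 \<Rightarrow> real^3 \<Rightarrow> real^3" where
  "table_prod t x y = (\<Sum>((i, j), v) \<leftarrow> t. (x $ i * y $ j) *\<^sub>R v)"

definition br_2g21_g1 :: "real^3 \<Rightarrow> real^3 \<Rightarrow> real^3" where
  "br_2g21_g1 = table_prod [((1, 2), e1), ((2, 1), - e1)]"

(* Names of the algebras in the list, applied to their parameters in the order of the equations of
   table.  The parameters lambda, lambda_1, lambda_2 are written l, l1, l2. *)
datatype listed_algebra =
    H1_1 real real
  | H1_2
  | H1_3 real
  | H1_4 real
  | H1_5 real real
  | H1_6 real
  | H1_7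
  | H1_8 real
  | H1_9 real real
  | H1_10 real real
  | H1_11
  | H1_12 real
  | H1_13 real
  | H2_1 real real
  | H2_2 real
  | H2_3
  | H2_4 real
  | H2_5 real
  | H2_6
  | H2_7 real
  | H2_8 real real
  | H2_9 real real real
  | H2_10 real real
  | H2_11 real
  | H2_12
  | H2_13
  | H2_14
  | H2_15 real
  | H2_16 real
  | H3_1 real
  | H3_2
  | H3_3 real
  | H3_4 real
  | H3_5
  | H3_6 real
  | H4_1 real
  | H4_2
  | H4_3 real
  | H4_4 real
  | H4_5 real
  | H4_6 real real
  | H5_1 real real
  | H5_2 real

primrec admissible :: "listed_algebra \<Rightarrow> bool" where
    "admissible (H1_1 l \<delta>) \<longleftrightarrow> \<delta> \<in> {0, 1}"
  | "admissible H1_2 \<longleftrightarrow> True"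
  | "admissible (H1_3 \<delta>) \<longleftrightarrow> \<delta> \<in> {0, 1}"
  | "admissible (H1_4 \<epsilon>1) \<longleftrightarrow> \<epsilon>1 \<in> {1, - 1}"
  | "admissible (H1_5 l \<delta>) \<longleftrightarrow> \<delta> \<in> {0, 1}"
  | "admissible (H1_6 \<delta>) \<longleftrightarrow> \<delta> \<in> {0, 1}"
  | "admissible H1_7 \<longleftrightarrow> True"
  | "admissible (H1_8 l1) \<longleftrightarrow> True"
  | "admissible (H1_9 l l1) \<longleftrightarrow> l1 \<noteq> 0"
  | "admissible (H1_10 \<epsilon> l1) \<longleftrightarrow> \<epsilon> \<in> {1, - 1}"
  | "admissible H1_11 \<longleftrightarrow> True"
  | "admissible (H1_12 l1) \<longleftrightarrow> True"
  | "admissible (H1_13 l2) \<longleftrightarrow> True"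
  | "admissible (H2_1 \<mu> \<delta>) \<longleftrightarrow> \<mu> \<noteq> 0 \<and> \<delta> \<in> {0, 1}"
  | "admissible (H2_2 \<mu>) \<longleftrightarrow> \<mu> \<noteq> 0"
  | "admissible H2_3 \<longleftrightarrow> True"
  | "admissible (H2_4 \<delta>) \<longleftrightarrow> \<delta> \<in> {0, 1}"
  | "admissible (H2_5 \<epsilon>1) \<longleftrightarrow> \<epsilon>1 \<in> {1, - 1}"
  | "admissible H2_6 \<longleftrightarrow> True"
  | "admissible (H2_7 \<mu>) \<longleftrightarrow> \<mu> \<noteq> 0"
  | "admissible (H2_8 \<delta>1 \<delta>2) \<longleftrightarrow> \<delta>1 \<in> {0, 1} \<and> \<delta>2 \<in> {0, 1} \<and> \<delta>1\<^sup>2 + \<delta>2\<^sup>2 \<noteq> 0"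
  | "admissible (H2_9 \<mu> \<epsilon> \<mu>1) \<longleftrightarrow> \<mu> \<noteq> 0 \<and> \<epsilon> \<in> {1, - 1}"
  | "admissible (H2_10 \<mu> \<mu>1) \<longleftrightarrow> \<mu> \<noteq> 0"
  | "admissible (H2_11 \<mu>) \<longleftrightarrow> \<mu> \<noteq> 0"
  | "admissible H2_12 \<longleftrightarrow> True"
  | "admissible H2_13 \<longleftrightarrow> True"
  | "admissible H2_14 \<longleftrightarrow> True"
  | "admissible (H2_15 \<mu>2) \<longleftrightarrow> \<mu>2 \<noteq> 0"
  | "admissible (H2_16 \<delta>) \<longleftrightarrow> \<delta> \<in> {0, 1}"
  | "admissible (H3_1 \<delta>) \<longleftrightarrow> \<delta> \<in> {0, 1}"
  | "admissible H3_2 \<longleftrightarrow> True"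
  | "admissible (H3_3 l1) \<longleftrightarrow> l1 \<noteq> 0"
  | "admissible (H3_4 \<epsilon>1) \<longleftrightarrow> \<epsilon>1 \<in> {1, - 1}"
  | "admissible H3_5 \<longleftrightarrow> True"
  | "admissible (H3_6 l2) \<longleftrightarrow> l2 \<noteq> 0"
  | "admissible (H4_1 \<delta>) \<longleftrightarrow> \<delta> \<in> {0, 1}"
  | "admissible H4_2 \<longleftrightarrow> True"
  | "admissible (H4_3 l1) \<longleftrightarrow> l1 \<noteq> 0"
  | "admissible (H4_4 \<epsilon>1) \<longleftrightarrow> \<epsilon>1 \<in> {1, - 1}"
  | "admissible (H4_5 l1) \<longleftrightarrow> l1 \<noteq> 0"
  | "admissible (H4_6 \<epsilon> l2) \<longleftrightarrow> \<epsilon> \<in> {1, - 1} \<and> l2 \<noteq> 1 \<and> l2 \<noteq> - 1"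
  | "admissible (H5_1 \<epsilon> \<delta>) \<longleftrightarrow> \<epsilon> \<in> {1, - 1} \<and> \<delta> \<in> {0, 1}"
  | "admissible (H5_2 \<epsilon>) \<longleftrightarrow> \<epsilon> \<in> {1, - 1}"

primrec table :: "listed_algebra \<Rightarrow> ((3 \<times> 3) \<times> (real^3)) list" where
    "table (H1_1 l \<delta>) =
       [((1, 2), l *\<^sub>R e1), ((2, 1), (l - 1) *\<^sub>R e1), ((2, 2), l *\<^sub>R e2),
        ((3, 3), \<delta> *\<^sub>R e3)]"
  | "table H1_2 =
       [((1, 2), - e1 + e3), ((2, 1), (- 2) *\<^sub>R e1 + e3), ((2, 2), - e2), ((2, 3), - e3),
        ((3, 2), - e3)]"
  | "table (H1_3 \<delta>) =
       [((1, 2), e1), ((2, 2), e2), ((3, 3), e1 + \<delta> *\<^sub>R e3)]"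
  | "table (H1_4 \<epsilon>1) =
       [((1, 1), \<epsilon>1 *\<^sub>R e3), ((1, 2), 2 *\<^sub>R e1), ((2, 1), e1),
        ((2, 2), 2 *\<^sub>R e2)]"
  | "table (H1_5 l \<delta>) =
       [((1, 2), l *\<^sub>R e1), ((2, 1), (l - 1) *\<^sub>R e1),
        ((2, 2), l *\<^sub>R e2 + \<delta> *\<^sub>R e3), ((2, 3), l *\<^sub>R e3),
        ((3, 2), l *\<^sub>R e3)]"
  | "table (H1_6 \<delta>) =
       [((1, 2), e1), ((2, 2), e2 + \<delta> *\<^sub>R e3), ((2, 3), e1 + e3),
        ((3, 2), e1 + e3)]"
  | "table H1_7 =
       [((1, 2), - e1), ((1, 3), e1), ((2, 1), (- 2) *\<^sub>R e1), ((2, 2), - e2),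
        ((2, 3), e2), ((3, 1), e1), ((3, 2), e2), ((3, 3), e3)]"
  | "table (H1_8 l1) =
       [((2, 1), - e1), ((2, 2), l1 *\<^sub>R e3), ((2, 3), e2), ((3, 2), e2), ((3, 3), e3)]"
  | "table (H1_9 l l1) =
       [((1, 2), l *\<^sub>R e1), ((1, 3), e1), ((2, 1), (l - 1) *\<^sub>R e1),
        ((2, 2), l *\<^sub>R e2), ((2, 3), e2), ((3, 1), e1), ((3, 2), e2),
        ((3, 3), l1 *\<^sub>R e2 + (1 - l * l1) *\<^sub>R e3)]"
  | "table (H1_10 \<epsilon> l1) =
       [((2, 1), - e1), ((3, 3), \<epsilon> *\<^sub>R e2 + l1 *\<^sub>R e3)]"
  | "table H1_11 =
       [((1, 2), e1), ((1, 3), e1), ((2, 2), e2), ((2, 3), e2), ((3, 1), e1), ((3, 2), e2),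
        ((3, 3), e1 + e3)]"
  | "table (H1_12 l1) =
       [((1, 3), e1), ((2, 1), - e1), ((2, 3), e2), ((3, 1), e1), ((3, 2), e2),
        ((3, 3), l1 *\<^sub>R e2 + e3)]"
  | "table (H1_13 l2) =
       [((1, 3), e1), ((2, 1), - e1), ((3, 1), e1), ((3, 3), l2 *\<^sub>R e2 + e3)]"
  | "table (H2_1 \<mu> \<delta>) =
       [((2, 1), - e1), ((2, 2), \<mu> *\<^sub>R e2), ((3, 3), \<delta> *\<^sub>R e3)]"
  | "table (H2_2 \<mu>) =
       [((2, 1), - e1), ((2, 2), \<mu> *\<^sub>R e2), ((2, 3), \<mu> *\<^sub>R e3),
        ((3, 2), \<mu> *\<^sub>R e3)]"
  | "table H2_3 =
       [((2, 1), - e1), ((2, 2), - e2), ((2, 3), - e3), ((3, 2), - e3)]"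
  | "table (H2_4 \<delta>) =
       [((2, 1), - e1), ((2, 2), - e2), ((2, 3), - e3), ((3, 2), - e3),
        ((3, 3), e1 + \<delta> *\<^sub>R e3)]"
  | "table (H2_5 \<epsilon>1) =
       [((1, 1), \<epsilon>1 *\<^sub>R e3), ((2, 1), - e1), ((2, 2), (- 2) *\<^sub>R e2),
        ((2, 3), (- 2) *\<^sub>R e3), ((3, 2), (- 2) *\<^sub>R e3)]"
  | "table H2_6 =
       [((1, 2), e3), ((2, 1), - e1 + e3), ((2, 2), e2)]"
  | "table (H2_7 \<mu>) =
       [((1, 3), e1), ((2, 1), - e1), ((2, 2), \<mu> *\<^sub>R e2), ((3, 1), e1), ((3, 3), e3)]"
  | "table (H2_8 \<delta>1 \<delta>2) =
       [((1, 3), \<delta>1 *\<^sub>R e1 + \<delta>2 *\<^sub>R e2), ((2, 1), - e1),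
        ((2, 2), - e2), ((3, 1), \<delta>1 *\<^sub>R e1 + \<delta>2 *\<^sub>R e2),
        ((3, 3), \<delta>1 *\<^sub>R e3)]"
  | "table (H2_9 \<mu> \<epsilon> \<mu>1) =
       [((2, 1), - e1), ((2, 2), \<mu> *\<^sub>R e2), ((2, 3), \<mu> *\<^sub>R e3),
        ((3, 2), \<mu> *\<^sub>R e3), ((3, 3), \<epsilon> *\<^sub>R e2 + \<mu>1 *\<^sub>R e3)]"
  | "table (H2_10 \<mu> \<mu>1) =
       [((1, 3), e1), ((2, 1), - e1), ((2, 2), \<mu> *\<^sub>R e2),
        ((2, 3), \<mu>1 *\<^sub>R e2), ((3, 1), e1), ((3, 2), \<mu>1 *\<^sub>R e2),
        ((3, 3), (\<mu>1 * (\<mu>1 - 1) / \<mu>) *\<^sub>R e2 + e3)]"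
  | "table (H2_11 \<mu>) =
       [((2, 1), - e1), ((2, 2), \<mu> *\<^sub>R e2), ((2, 3), e2), ((3, 2), e2),
        ((3, 3), (1 / \<mu>) *\<^sub>R e2)]"
  | "table H2_12 =
       [((2, 1), - e1), ((2, 2), - e2), ((2, 3), e2), ((3, 2), e2), ((3, 3), e3)]"
  | "table H2_13 =
       [((2, 1), - e1), ((2, 2), - e2), ((2, 3), e1), ((3, 2), e1)]"
  | "table H2_14 =
       [((1, 3), e1), ((2, 1), - e1), ((2, 2), - e2), ((2, 3), e1 + e2), ((3, 1), e1),
        ((3, 2), e1 + e2), ((3, 3), - e1 + e3)]"
  | "table (H2_15 \<mu>2) =
       [((2, 1), - e1), ((2, 2), - e2 + \<mu>2 *\<^sub>R e3), ((2, 3), e2), ((3, 2), e2),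
        ((3, 3), e3)]"
  | "table (H2_16 \<delta>) =
       [((2, 1), - e1), ((2, 2), - e2 + \<delta> *\<^sub>R e3), ((2, 3), e1), ((3, 2), e1)]"
  | "table (H3_1 \<delta>) =
       [((2, 1), - e1), ((2, 2), e1 - e2), ((3, 3), \<delta> *\<^sub>R e3)]"
  | "table H3_2 =
       [((2, 1), - e1), ((2, 2), e1 - e2), ((2, 3), - e3), ((3, 2), - e3)]"
  | "table (H3_3 l1) =
       [((2, 1), - e1), ((2, 2), e1 - e2), ((2, 3), - e3), ((3, 2), - e3),
        ((3, 3), l1 *\<^sub>R e1 + e3)]"
  | "table (H3_4 \<epsilon>1) =
       [((2, 1), - e1), ((2, 2), e1 - e2), ((2, 3), - e3), ((3, 2), - e3),
        ((3, 3), \<epsilon>1 *\<^sub>R e1)]"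
  | "table H3_5 =
       [((1, 3), e1), ((2, 1), - e1), ((2, 2), e1 - e2), ((2, 3), e2), ((3, 1), e1),
        ((3, 2), e2), ((3, 3), e3)]"
  | "table (H3_6 l2) =
       [((1, 3), e1), ((2, 1), - e1), ((2, 2), e1 - e2), ((2, 3), l2 *\<^sub>R e1 + e2),
        ((3, 1), e1), ((3, 2), l2 *\<^sub>R e1 + e2), ((3, 3), (- l2) *\<^sub>R e1 + e3)]"
  | "table (H4_1 \<delta>) =
       [((1, 2), e1), ((2, 2), e1 + e2), ((3, 3), \<delta> *\<^sub>R e3)]"
  | "table H4_2 =
       [((1, 2), e1), ((2, 2), e1 + e2), ((2, 3), e3), ((3, 2), e3)]"
  | "table (H4_3 l1) =
       [((1, 2), e1), ((2, 2), e1 + e2), ((3, 3), l1 *\<^sub>R e1 + e3)]"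
  | "table (H4_4 \<epsilon>1) =
       [((1, 2), e1), ((2, 2), e1 + e2), ((3, 3), \<epsilon>1 *\<^sub>R e1)]"
  | "table (H4_5 l1) =
       [((1, 2), e1), ((1, 3), e1), ((2, 2), e1 + e2), ((2, 3), e2), ((3, 1), e1),
        ((3, 2), e2), ((3, 3), l1 *\<^sub>R e1 + e3)]"
  | "table (H4_6 \<epsilon> l2) =
       [((1, 2), e1), ((2, 2), e1 + e2), ((3, 3), \<epsilon> *\<^sub>R e1 + l2 *\<^sub>R e3)]"
  | "table (H5_1 \<epsilon> \<delta>) =
       [((1, 1), \<epsilon> *\<^sub>R e2), ((2, 1), - e1), ((2, 2), (- 2) *\<^sub>R e2),
        ((3, 3), \<delta> *\<^sub>R e3)]"
  | "table (H5_2 \<epsilon>) =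
       [((1, 1), \<epsilon> *\<^sub>R e2), ((1, 3), e1), ((2, 1), - e1),
        ((2, 2), (- 2) *\<^sub>R e2), ((2, 3), e2), ((3, 1), e1), ((3, 2), e2), ((3, 3), e3)]"

definition prod_of :: "listed_algebra \<Rightarrow> real^3 \<Rightarrow> real^3 \<Rightarrow> real^3" where
  "prod_of h = table_prod (table h)"

definition listed :: "listed_algebra set" where
  "listed = {h. admissible h}"

end

theory Submission
  imports Defs
begin

text \<open>Flatness, associativity, the Novikov identity and bi-symmetry are equalities of multilinear
  maps, hence may be checked on basis vectors, where they become polynomial equations in the
  parameters. For completeness, either the cube of every right multiplication vanishes, or some right
  multiplication has an eigenvector with nonzero eigenvalue.\<close>

text \<open>Linear maps that agree on \<open>Basis\<close> are equal; this frees one argument at a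
  time, first \<open>z\<close>, then \<open>y\<close>, then \<open>x\<close>.\<close>

lemma trilinear_eq_iff_Basis:
  fixes f g :: "'a::euclidean_space \<Rightarrow> 'a \<Rightarrow> 'a \<Rightarrow> 'b::real_vector"
  assumes f: "\<And>y z. linear (\<lambda>x. f x y z)" "\<And>x z. linear (\<lambda>y. f x y z)" "\<And>x y. linear (f x y)"
    and g: "\<And>y z. linear (\<lambda>x. g x y z)" "\<And>x z. linear (\<lambda>y. g x y z)" "\<And>x y. linear (g x y)"
  shows "(\<forall>x y z. f x y z = g x y z) \<longleftrightarrow>
    (\<forall>x\<in>Basis. \<forall>y\<in>Basis. \<forall>z\<in>Basis. f x y z = g x y z)"
proof (intro iffI allI)
  fix x y z
  assume *: "\<forall>x\<in>Basis. \<forall>y\<in>Basis. \<forall>z\<in>Basis. f x y z = g x y z"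
  have "f x y = g x y" if "x \<in> Basis" "y \<in> Basis" for x y
    using that * f g by (intro linear_eq_stdbasis) auto
  then have "(\<lambda>y. f x y z) = (\<lambda>y. g x y z)" if "x \<in> Basis" for x z
    using that f g by (intro linear_eq_stdbasis) auto
  then have "(\<lambda>x. f x y z) = (\<lambda>x. g x y z)"
    using f g by (intro linear_eq_stdbasis) (auto dest: fun_cong)
  then show "f x y z = g x y z" by (rule fun_cong)
qed auto

text \<open>Supplies the linearity in each argument of both bracketings; \<open>q\<close> will be
  the product itself or the Lie bracket.\<close>

lemma linear_bilinear_compose:
  assumes "bilinear p" "bilinear q"
  shows "linear (\<lambda>x. p (q x y) z)" "linear (\<lambda>y. p (q x y) z)" "linear (\<lambda>z. p (q x y) z)"
    "linear (\<lambda>x. p x (q y z))" "linear (\<lambda>y. p x (q y z))" "linear (\<lambda>z. p x (q y z))"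
  using assms by (auto simp: bilinear_def linear_iff)

lemma associative_prod_iff_Basis:
  fixes p :: "'a::euclidean_space \<Rightarrow> 'a \<Rightarrow> 'a"
  assumes "bilinear p"
  shows "associative_prod p \<longleftrightarrow>
    (\<forall>x\<in>Basis. \<forall>y\<in>Basis. \<forall>z\<in>Basis. p (p x y) z = p x (p y z))"
  unfolding associative_prod_def associator_def right_minus_eq
  by (intro trilinear_eq_iff_Basis linear_bilinear_compose[OF assms assms])

lemma novikov_prod_iff_Basis:
  fixes p :: "'a::euclidean_space \<Rightarrow> 'a \<Rightarrow> 'a"
  assumes "bilinear p"
  shows "novikov_prod p \<longleftrightarrow>
    (\<forall>x\<in>Basis. \<forall>y\<in>Basis. \<forall>z\<in>Basis. p (p z y) x = p (p z x) y)"
  unfolding novikov_prod_def right_mult_def fun_eq_iff comp_apply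
  by (intro trilinear_eq_iff_Basis linear_bilinear_compose[OF assms assms])

lemma bisymmetric_prod_iff_Basis:
  fixes p :: "'a::euclidean_space \<Rightarrow> 'a \<Rightarrow> 'a"
  assumes "bilinear p"
  shows "bisymmetric_prod p \<longleftrightarrow>
    (\<forall>x\<in>Basis. \<forall>y\<in>Basis. \<forall>z\<in>Basis. p (p x y) z - p x (p y z) = p (p x z) y - p x (p z y))"
  unfolding bisymmetric_prod_def associator_def
  by (intro trilinear_eq_iff_Basis linear_compose_sub linear_bilinear_compose[OF assms assms])

lemma flat_lie_algebra_iff_Basis:
  fixes p :: "'a::euclidean_space \<Rightarrow> 'a \<Rightarrow> 'a"
  assumes "lie_algebra br" "bilinear p"
  shows "flat_lie_algebra br p \<longleftrightarrow>
    (\<forall>x\<in>Basis. \<forall>y\<in>Basis. p x y - p y x = br x y) \<and>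
    (\<forall>x\<in>Basis. \<forall>y\<in>Basis. \<forall>z\<in>Basis. p (br x y) z = p x (p y z) - p y (p x z))"
proof -
  have br: "bilinear br"
    using assms(1) by (simp add: lie_algebra_def)
  have "bilinear (\<lambda>x y. p x y - p y x)"
    using assms(2) by (auto simp: bilinear_def intro: linear_compose_sub)
  then have "(\<lambda>x y. p x y - p y x) = br"
    if "\<forall>x\<in>Basis. \<forall>y\<in>Basis. p x y - p y x = br x y"
    using that by (intro bilinear_eq_stdbasis br) auto
  then have "(\<forall>x y. p x y - p y x = br x y) \<longleftrightarrow>
      (\<forall>x\<in>Basis. \<forall>y\<in>Basis. p x y - p y x = br x y)"
    unfolding fun_eq_iff by (intro iffI ballI) simp_all
  moreover have "(\<forall>x y z. p (br x y) z = p x (p y z) - p y (p x z)) \<longleftrightarrow>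
      (\<forall>x\<in>Basis. \<forall>y\<in>Basis. \<forall>z\<in>Basis. p (br x y) z = p x (p y z) - p y (p x z))"
    by (intro trilinear_eq_iff_Basis linear_compose_sub linear_bilinear_compose[OF assms(2) br]
        linear_bilinear_compose[OF assms(2) assms(2)])
  ultimately show ?thesis
    unfolding flat_lie_algebra_def using assms by argo
qed

text \<open>The exponent 3 is enough on \<open>real^3\<close>: a nilpotent endomorphism of a
  3-dimensional space has vanishing cube.\<close>

lemma complete_prodI:
  assumes "\<And>x y. p (p (p y x) x) x = 0"
  shows "complete_prod p"
proof -
  have "right_mult p x ^^ 3 = (\<lambda>_. 0)" for x
    using assms by (simp add: fun_eq_iff right_mult_def numeral_3_eq_3)
  then show ?thesis
    unfolding complete_prod_def nilpotent_map_def by blast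
qed

text \<open>Every power of the right multiplication by \<open>x\<close> sends \<open>v\<close> to a
  nonzero multiple of itself.\<close>

lemma not_complete_prodI:
  assumes "bilinear p" "p v x = c *\<^sub>R v" "c \<noteq> 0" "v \<noteq> 0"
  shows "\<not> complete_prod p"
proof
  assume "complete_prod p"
  then obtain n where "right_mult p x ^^ n = (\<lambda>_. 0)"
    by (auto simp: complete_prod_def nilpotent_map_def)
  moreover have "(right_mult p x ^^ n) v = c ^ n *\<^sub>R v"
    using assms(1,2) by (induction n) (auto simp: right_mult_def bilinear_lmul)
  ultimately show False
    using assms(3,4) by simp
qed

lemma bilinear_table_prod: "bilinear (table_prod t)"
proof -
  have "linear (table_prod t x)" for x
    unfolding table_prod_def linear_iff
    by (induction t) (auto simp: algebra_simps split: prod.splits)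
  moreover have "linear (\<lambda>x. table_prod t x y)" for y
    unfolding table_prod_def linear_iff
    by (induction t) (auto simp: algebra_simps split: prod.splits)
  ultimately show ?thesis
    by (simp add: bilinear_def)
qed

lemma bilinear_prod_of: "bilinear (prod_of h)"
  by (simp add: prod_of_def bilinear_table_prod)

text \<open>Recursion over the table lets the simplifier find products of basis vectors without
  passing to coordinates.\<close>

lemma table_prod_axis:
  "table_prod [] x y = 0"
  "table_prod (((i, j), v) # t) (axis k 1) (axis l 1) =
     (if k = i \<and> l = j then v else 0) + table_prod t (axis k 1) (axis l 1)"
  by (auto simp: table_prod_def axis_def)

lemma ball_Basis_3: "(\<forall>b\<in>Basis. P (b :: real^3)) \<longleftrightarrow> P e1 \<and> P e2 \<and> P e3"
  by (auto simp: Basis_vec_def forall_3)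

lemma vec3_eq_iff: "x = y \<longleftrightarrow> x $ 1 = y $ 1 \<and> x $ 2 = y $ 2 \<and> x $ 3 = y $ 3" for x y :: "'a^3"
  by (auto simp: vec_eq_iff forall_3)

text \<open>In an iterated product of basis vectors the inner product is a linear combination of
  basis vectors; distributing the outer product over it makes \<open>table_prod_axis\<close> apply
  again.\<close>

lemmas table_prod_linear =
  bilinear_lzero[OF bilinear_table_prod] bilinear_rzero[OF bilinear_table_prod]
  bilinear_ladd[OF bilinear_table_prod] bilinear_radd[OF bilinear_table_prod]
  bilinear_lsub[OF bilinear_table_prod] bilinear_rsub[OF bilinear_table_prod]
  bilinear_lneg[OF bilinear_table_prod] bilinear_rneg[OF bilinear_table_prod]
  bilinear_lmul[OF bilinear_table_prod] bilinear_rmul[OF bilinear_table_prod]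

lemma axis_component: "axis i c $ j = (if j = i then c else 0)"
  by (simp add: axis_def)

lemmas table_prod_eval = table_prod_axis table_prod_linear ball_Basis_3

lemma lie_algebra_br_2g21_g1: "lie_algebra br_2g21_g1"
  unfolding lie_algebra_def br_2g21_g1_def
  by (auto simp: bilinear_table_prod table_prod_def vec3_eq_iff axis_component algebra_simps)

text \<open>For each name the iterated products are evaluated first; comparing coordinates then
  leaves scalar identities in the parameters. That \<mu> is nonzero cancels the denominators in
  \<open>H2_10\<close> and \<open>H2_11\<close>.\<close>

lemma flat_lie_algebra_prod_of:
  assumes "admissible h"
  shows "flat_lie_algebra br_2g21_g1 (prod_of h)"
  unfolding flat_lie_algebra_iff_Basis[OF lie_algebra_br_2g21_g1 bilinear_prod_of]
  unfolding prod_of_def br_2g21_g1_def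
  using assms
  by (cases h; simp add: table_prod_eval;
      auto simp: vec3_eq_iff axis_component algebra_simps)

text \<open>If \<open>e2 e1 = a e1\<close> and \<open>e2 e2 = b e2\<close>, the triple
  \<open>(e2, e2, e1)\<close> gives \<open>a b = a a\<close>. This forces \<lambda> = 1 in
  \<open>H1_1\<close> and \<mu> = -1 in \<open>H2_1\<close>, \<open>H2_2\<close> and
  \<open>H2_10\<close>; in the last, \<open>(e2, e3, e1)\<close> gives \<open>\<mu>1 = 1\<close>.
  \<open>H2_2 (- 1)\<close> and \<open>H2_3\<close> are distinct names of the same product.\<close>

lemma associative_prod_prod_of_iff:
  assumes "admissible h"
  shows "associative_prod (prod_of h) \<longleftrightarrow> h \<in>
      {H1_1 1 \<delta> | \<delta>. \<delta> \<in> {0, 1}} \<union> {H1_5 1 \<delta> | \<delta>. \<delta> \<in> {0, 1}} \<union>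
      {H2_1 (- 1) \<delta> | \<delta>. \<delta> \<in> {0, 1}} \<union> {H2_2 (- 1), H2_3, H2_10 (- 1) 1}"
  unfolding prod_of_def associative_prod_iff_Basis[OF bilinear_table_prod]
  using assms
  by (cases h; simp add: table_prod_eval;
      auto simp: vec3_eq_iff axis_component algebra_simps)

lemma novikov_prod_prod_of_iff:
  assumes "admissible h"
  shows "novikov_prod (prod_of h) \<longleftrightarrow> h \<in>
      {H1_1 l \<delta> | l \<delta>. \<delta> \<in> {0, 1}} \<union> {H1_5 l \<delta> | l \<delta>. \<delta> \<in> {0, 1}} \<union>
      {H4_1 \<delta> | \<delta>. \<delta> \<in> {0, 1}} \<union> {H4_2}"
  unfolding prod_of_def novikov_prod_iff_Basis[OF bilinear_table_prod]
  using assms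
  by (cases h; simp add: table_prod_eval;
      auto simp: vec3_eq_iff axis_component algebra_simps)

text \<open>Flatness makes the associator symmetric in its first two arguments, so bi-symmetry means
  total symmetry. The listed members of the families \<open>H3\<close> and \<open>H4\<close> are not
  associative: there the associator of \<open>(e2, e2, e2)\<close> is \<open>e1\<close>.\<close>

lemma bisymmetric_prod_prod_of_iff:
  assumes "admissible h"
  shows "bisymmetric_prod (prod_of h) \<longleftrightarrow> h \<in>
      {H1_1 1 \<delta> | \<delta>. \<delta> \<in> {0, 1}} \<union> {H1_5 1 \<delta> | \<delta>. \<delta> \<in> {0, 1}} \<union>
      {H2_1 (- 1) \<delta> | \<delta>. \<delta> \<in> {0, 1}} \<union> {H2_2 (- 1), H2_3} \<union>
      {H3_1 \<delta> | \<delta>. \<delta> \<in> {0, 1}} \<union> {H3_2, H3_5} \<union>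
      {H4_1 \<delta> | \<delta>. \<delta> \<in> {0, 1}} \<union> {H4_2} \<union> {H2_10 (- 1) 1}"
  unfolding prod_of_def bisymmetric_prod_iff_Basis[OF bilinear_table_prod]
  using assms
  by (cases h; simp add: table_prod_eval;
      auto simp: vec3_eq_iff axis_component algebra_simps)

text \<open>In \<open>H1_10\<close> a right multiplication sends \<open>e3\<close> to a multiple of
  \<open>e2\<close>, \<open>e2\<close> to a multiple of \<open>e1\<close>, and \<open>e1\<close> to
  0. In the other two cases its image lies in the span of \<open>e1\<close> and \<open>e3\<close>,
  which it kills.\<close>

lemma complete_prod_prod_of:
  assumes "h \<in> {H1_1 0 0} \<union> {H1_5 0 \<delta> | \<delta>. \<delta> \<in> {0, 1}} \<union> {H1_10 \<epsilon> 0 | \<epsilon>. \<epsilon> \<in> {1, - 1}}"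
  shows "complete_prod (prod_of h)"
proof (rule complete_prodI)
  fix x y
  show "prod_of h (prod_of h (prod_of h y x) x) x = 0"
    using assms unfolding prod_of_def by (auto simp: table_prod_def vec3_eq_iff axis_component)
qed

text \<open>\<open>eigen_data h = (v, x, c)\<close> encodes an eigenvector \<open>v\<close> of the right multiplication by \<open>x\<close>
  with eigenvalue \<open>c\<close>; among the admissible parameters \<open>c = 0\<close> occurs only for complete \<open>h\<close>.\<close>
primrec eigen_data :: "listed_algebra \<Rightarrow> (real^3) \<times> (real^3) \<times> real" where
    "eigen_data (H1_1 l \<delta>) = (if l = 0 then (e3, e3, \<delta>) else (e1, e2, l))"
  | "eigen_data H1_2 = (e2, e2, - 1)"
  | "eigen_data (H1_3 \<delta>) = (e2, e2, 1)"
  | "eigen_data (H1_4 \<epsilon>1) = (e2, e2, 2)"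
  | "eigen_data (H1_5 l \<delta>) = (e1, e2, l)"
  | "eigen_data (H1_6 \<delta>) = (e1, e2, 1)"
  | "eigen_data H1_7 = (e1, e3, 1)"
  | "eigen_data (H1_8 l1) = (e2, e3, 1)"
  | "eigen_data (H1_9 l l1) = (e1, e3, 1)"
  \<comment> \<open>This vector is \<open>e3 e3\<close>; as \<open>e2 e3 = 0\<close>, multiplying it
    by \<open>e3\<close> on the right gives \<open>l1\<close> times itself.\<close>
  | "eigen_data (H1_10 \<epsilon> l1) = (\<epsilon> *\<^sub>R e2 + l1 *\<^sub>R e3, e3, l1)"
  | "eigen_data H1_11 = (e1, e3, 1)"
  | "eigen_data (H1_12 l1) = (e1, e3, 1)"
  | "eigen_data (H1_13 l2) = (e1, e3, 1)"
  | "eigen_data (H2_1 \<mu> \<delta>) = (e2, e2, \<mu>)"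
  | "eigen_data (H2_2 \<mu>) = (e2, e2, \<mu>)"
  | "eigen_data H2_3 = (e2, e2, - 1)"
  | "eigen_data (H2_4 \<delta>) = (e2, e2, - 1)"
  | "eigen_data (H2_5 \<epsilon>1) = (e2, e2, - 2)"
  | "eigen_data H2_6 = (e2, e2, 1)"
  | "eigen_data (H2_7 \<mu>) = (e2, e2, \<mu>)"
  | "eigen_data (H2_8 \<delta>1 \<delta>2) = (e2, e2, - 1)"
  | "eigen_data (H2_9 \<mu> \<epsilon> \<mu>1) = (e2, e2, \<mu>)"
  | "eigen_data (H2_10 \<mu> \<mu>1) = (e2, e2, \<mu>)"
  | "eigen_data (H2_11 \<mu>) = (e2, e2, \<mu>)"
  | "eigen_data H2_12 = (e2, e2, - 1)"
  | "eigen_data H2_13 = (e2, e2, - 1)"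
  | "eigen_data H2_14 = (e2, e2, - 1)"
  | "eigen_data (H2_15 \<mu>2) = (e2, e3, 1)"
  \<comment> \<open>Right multiplication by \<open>e2\<close> sends \<open>e1\<close> to 0,
    \<open>e2\<close> to \<open>- e2 + \<delta> e3\<close> and \<open>e3\<close> to
    \<open>e1\<close>; solving for eigenvalue -1 with \<open>e2\<close>-coordinate 1 gives this
    vector.\<close>
  | "eigen_data (H2_16 \<delta>) = (\<delta> *\<^sub>R e1 + e2 - \<delta> *\<^sub>R e3, e2, - 1)"
  \<comment> \<open>In this family \<open>e2 e2 = e1 - e2\<close> and \<open>e1 e2 = 0\<close>, so
    \<open>e2 e2\<close> is itself the eigenvector.\<close>
  | "eigen_data (H3_1 \<delta>) = (e1 - e2, e2, - 1)"
  | "eigen_data H3_2 = (e1 - e2, e2, - 1)"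
  | "eigen_data (H3_3 l1) = (e1 - e2, e2, - 1)"
  | "eigen_data (H3_4 \<epsilon>1) = (e1 - e2, e2, - 1)"
  | "eigen_data H3_5 = (e1 - e2, e2, - 1)"
  | "eigen_data (H3_6 l2) = (e1 - e2, e2, - 1)"
  | "eigen_data (H4_1 \<delta>) = (e1, e2, 1)"
  | "eigen_data H4_2 = (e1, e2, 1)"
  | "eigen_data (H4_3 l1) = (e1, e2, 1)"
  | "eigen_data (H4_4 \<epsilon>1) = (e1, e2, 1)"
  | "eigen_data (H4_5 l1) = (e1, e2, 1)"
  | "eigen_data (H4_6 \<epsilon> l2) = (e1, e2, 1)"
  | "eigen_data (H5_1 \<epsilon> \<delta>) = (e2, e2, - 2)"
  | "eigen_data (H5_2 \<epsilon>) = (e2, e2, - 2)"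

lemma not_complete_prod_prod_of:
  assumes "admissible h"
    and "h \<notin> {H1_1 0 0} \<union> {H1_5 0 \<delta> | \<delta>. \<delta> \<in> {0, 1}} \<union> {H1_10 \<epsilon> 0 | \<epsilon>. \<epsilon> \<in> {1, - 1}}"
  shows "\<not> complete_prod (prod_of h)"
proof -
  obtain v x c where vxc: "eigen_data h = (v, x, c)"
    by (metis prod.exhaust)
  \<comment> \<open>Stated with \<open>case\<close> so that the triple is computed once
    \<open>h\<close> is split; that \<open>c\<close> and \<open>v\<close> are nonzero comes from
    admissibility and from the excluded names.\<close>
  have "case eigen_data h of (v, x, c) \<Rightarrow> prod_of h v x = c *\<^sub>R v \<and> c \<noteq> 0 \<and> v \<noteq> 0"
    using assms unfolding prod_of_def
    by (cases h; simp add: table_prod_eval; auto simp: vec3_eq_iff axis_component)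
  with vxc show ?thesis
    using not_complete_prodI[OF bilinear_prod_of, of h v x c] by simp
qed

lemma complete_prod_prod_of_iff:
  assumes "admissible h"
  shows "complete_prod (prod_of h) \<longleftrightarrow> h \<in>
      {H1_1 0 0} \<union> {H1_5 0 \<delta> | \<delta>. \<delta> \<in> {0, 1}} \<union> {H1_10 \<epsilon> 0 | \<epsilon>. \<epsilon> \<in> {1, - 1}}"
  by (rule iffI[OF contrapos_pp[OF _ not_complete_prod_prod_of[OF assms]] complete_prod_prod_of])

theorem corollary2:
  shows "(\<forall>h\<in>listed. flat_lie_algebra br_2g21_g1 (prod_of h)) \<and>
    {h \<in> listed. associative_prod (prod_of h)} =
      {H1_1 1 \<delta> | \<delta>. \<delta> \<in> {0, 1}} \<union> {H1_5 1 \<delta> | \<delta>. \<delta> \<in> {0, 1}} \<union>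
      {H2_1 (- 1) \<delta> | \<delta>. \<delta> \<in> {0, 1}} \<union> {H2_2 (- 1), H2_3, H2_10 (- 1) 1} \<and>
    {h \<in> listed. novikov_prod (prod_of h)} =
      {H1_1 l \<delta> | l \<delta>. \<delta> \<in> {0, 1}} \<union> {H1_5 l \<delta> | l \<delta>. \<delta> \<in> {0, 1}} \<union>
      {H4_1 \<delta> | \<delta>. \<delta> \<in> {0, 1}} \<union> {H4_2} \<and>
    {h \<in> listed. bisymmetric_prod (prod_of h)} =
      {H1_1 1 \<delta> | \<delta>. \<delta> \<in> {0, 1}} \<union> {H1_5 1 \<delta> | \<delta>. \<delta> \<in> {0, 1}} \<union>
      {H2_1 (- 1) \<delta> | \<delta>. \<delta> \<in> {0, 1}} \<union> {H2_2 (- 1), H2_3} \<union>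
      {H3_1 \<delta> | \<delta>. \<delta> \<in> {0, 1}} \<union> {H3_2, H3_5} \<union>
      {H4_1 \<delta> | \<delta>. \<delta> \<in> {0, 1}} \<union> {H4_2} \<union> {H2_10 (- 1) 1} \<and>
    {h \<in> listed. complete_prod (prod_of h)} =
      {H1_1 0 0} \<union> {H1_5 0 \<delta> | \<delta>. \<delta> \<in> {0, 1}} \<union> {H1_10 \<epsilon> 0 | \<epsilon>. \<epsilon> \<in> {1, - 1}}"
  (is "_ \<and> _ = ?A \<and> _ = ?N \<and> _ = ?B \<and> _ = ?C")
proof (intro conjI)
  show "\<forall>h\<in>listed. flat_lie_algebra br_2g21_g1 (prod_of h)"
    by (simp add: listed_def flat_lie_algebra_prod_of)
  \<comment> \<open>The characterisations assume admissibility, so it remains to see that each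
    right-hand set contains only admissible names.\<close>
  have restrict_eqI: "{h \<in> listed. P h} = A"
    if "A \<subseteq> listed" "\<And>h. admissible h \<Longrightarrow> P h \<longleftrightarrow> h \<in> A" for P A
    using that by (auto simp: listed_def)
  show "{h \<in> listed. associative_prod (prod_of h)} = ?A"
    by (rule restrict_eqI, force simp: listed_def, rule associative_prod_prod_of_iff)
  show "{h \<in> listed. novikov_prod (prod_of h)} = ?N"
    by (rule restrict_eqI, force simp: listed_def, rule novikov_prod_prod_of_iff)
  show "{h \<in> listed. bisymmetric_prod (prod_of h)} = ?B"
    by (rule restrict_eqI, force simp: listed_def, rule bisymmetric_prod_prod_of_iff)
  show "{h \<in> listed. complete_prod (prod_of h)} = ?C"
    by (rule restrict_eqI, force simp: listed_def, rule complete_prod_prod_of_iff)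
qed

end
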